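(* Let $\mathcal{L}$ denote either the $\mathbf{Q}$-vector space $\mathscr{L} \subset \mathbf{C}$ of complex logarithms of algebraic numbers, or, for a prime $p$, the $\mathbf{Q}$-vector space $\mathscr{L}_p \subset \mathbf{C}_p$ of $p$-adic logarithms of algebraic numbers. Suppose that the Structural Rank Conjecture holds for $\mathcal{L}$, that is: for all $m,n \ge 1$ and every $m \times n$ matrix $M$ with entries in $\mathcal{L}$, written as $M = \sum_{i=1}^k M_i \lambda_i$ with $M_i \in M_{m\times n}(\mathbf{Q})$ and $\lambda_1,\dots,\lambda_k \in \mathcal{L}$ linearly independent over $\mathbf{Q}$, the rank of $M$ equals the rank of $\sum_{i=1}^k M_i x_i$ viewed as a matrix over the rational function field $\mathbf{Q}(x_1,\dots,x_k)$. Then the Matrix Coefficient Conjecture holds for $\mathcal{L}$, that is: for every $n \ge 1$ and every $M \in M_{n\times n}(\mathcal{L})$ with $\det(M)=0$, there exist nonzero vectors $w, v \in \mathbf{Q}^n$ such that $\langle w, Mv\rangle = 0$.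
   Context: $\mathscr{L} = \{x \in \mathbf{C} : e^x \in \overline{\mathbf{Q}}\}$. For a prime $p$, fix an embedding $\overline{\mathbf{Q}} \subset \mathbf{C}_p$ and let $\mathscr{L}_p = \{\log_p(x) : x \in \overline{\mathbf{Q}}^*\} \subset \mathbf{C}_p$, where $\log_p$ is Iwasawa's $p$-adic logarithm on $\mathbf{C}_p^*$ (normalized by $\log_p(p)=0$). $\langle\ ,\ \rangle$ denotes the usual dot product. The rank of $M$ is its rank over $\mathbf{C}$ (respectively $\mathbf{C}_p$). *)

theory Defs
  imports
    "HOL-Analysis.Elementary_Metric_Spaces"
    "HOL-Library.Poly_Mapping"
    "HOL-Computational_Algebra.Polynomial_Factorial"
    "HOL-Computational_Algebra.Primes"
    "Jordan_Normal_Form.DL_Rank"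
begin

section \<open>Complex logarithms of algebraic numbers\<close>

definition complex_logs :: "complex set" where
  "complex_logs = {x. algebraic (exp x)}"


section \<open>The field of p-adic complex numbers and Iwasawa's logarithm\<close>

text \<open>
  The metric of \<open>'k\<close> plays the role of the p-adic absolute value.
\<close>

abbreviation abs_p :: "'k::{field_char_0, metric_space} \<Rightarrow> real" where
  "abs_p x \<equiv> dist x 0"

definition algebraic_over :: "'k::field set \<Rightarrow> 'k \<Rightarrow> bool" where
  "algebraic_over F x \<longleftrightarrow> (\<exists>f. f \<noteq> 0 \<and> (\<forall>i. coeff f i \<in> F) \<and> poly f x = 0)"

text \<open>
  The libraries contain no p-adic fields, so the p-adic complex numbers are described as they are
  defined: a completion of an algebraic closure of a completion of the rationals.  This determines
  \<open>'k\<close> up to isometric field isomorphism.  Inside a complete field \<open>'k\<close> whose absolute value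
  restricts to the p-adic one on the rationals, the topological closure of \<open>\<rat>\<close> is the
  field of p-adic numbers.  Completeness of \<open>'k\<close> is part of its sort.
\<close>

definition padic_numbers :: "'k::{field_char_0, metric_space} set" where
  "padic_numbers = closure \<rat>"

definition padic_closure :: "'k::{field_char_0, metric_space} set" where
  "padic_closure = {x. algebraic_over padic_numbers x}"

locale padic_complex_field =
  fixes type_of_field :: "'k::{field_char_0, complete_space} itself" and p :: nat
  assumes prime_p: "prime p"
    and dist_abs_p: "dist x y = abs_p (x - y :: 'k)"
    and abs_p_mult: "abs_p (x * y :: 'k) = abs_p x * abs_p y"
    and abs_p_ultrametric: "abs_p (x + y :: 'k) \<le> max (abs_p x) (abs_p y)"
    and abs_p_p: "abs_p (of_nat p :: 'k) = 1 / real p"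
    and padic_closure_alg_closed:
      "\<lbrakk>\<forall>i. coeff f i \<in> padic_closure; degree f > 0\<rbrakk> \<Longrightarrow> \<exists>x\<in>padic_closure. poly f (x :: 'k) = 0"
    and padic_closure_dense: "closure (padic_closure :: 'k set) = UNIV"

text \<open>
  Iwasawa's logarithm is the unique homomorphism from the multiplicative to the additive group that
  extends the usual power series and vanishes at \<open>p\<close>.  The value at \<open>0\<close>, where the
  logarithm is undefined, is set to \<open>0\<close> only to make the HOL function unique.
\<close>

definition iwasawa_log :: "nat \<Rightarrow> 'k::{field_char_0, metric_space} \<Rightarrow> 'k" where
  "iwasawa_log p = (THE l.
      (\<forall>x y. x \<noteq> 0 \<longrightarrow> y \<noteq> 0 \<longrightarrow> l (x * y) = l x + l y) \<and>
      (\<forall>x. abs_p x < 1 \<longrightarrow> (\<lambda>j. (-1) ^ j * x ^ Suc j / of_nat (Suc j)) sums l (1 + x)) \<and>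
      l (of_nat p) = 0 \<and> l 0 = 0)"

text \<open>
  The image of any embedding of the algebraic numbers into \<open>'k\<close> is the set of all elements of
  \<open>'k\<close> that are algebraic over \<open>\<rat>\<close>, so no embedding has to be chosen.
\<close>

definition padic_logs :: "nat \<Rightarrow> 'k::{field_char_0, metric_space} set" where
  "padic_logs p = iwasawa_log p ` {x. algebraic x \<and> x \<noteq> 0}"


section \<open>The two conjectures\<close>

text \<open>
  Rational functions are taken over all the variables \<open>x\<^sub>0, x\<^sub>1, \<dots>\<close>; the rational
  functions in the first \<open>k\<close> of them form a subfield, and the rank of a matrix over a
  subfield does not change under field extension.
\<close>

type_synonym ratfun = "((nat \<Rightarrow>\<^sub>0 nat) \<Rightarrow>\<^sub>0 rat) fract"

definition ratfun_const :: "rat \<Rightarrow> ratfun" where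
  "ratfun_const c = to_fract (Poly_Mapping.single 0 c)"

definition ratfun_var :: "nat \<Rightarrow> ratfun" where
  "ratfun_var i = to_fract (Poly_Mapping.single (Poly_Mapping.single i 1) 1)"

text \<open>
  The \<open>m \<times> n\<close> matrix with value \<open>A 0 * x 0 + \<dots> + A (k - 1) * x (k - 1)\<close>, where the
  rational entries are mapped to \<open>'b\<close> by \<open>emb\<close>.
\<close>

definition comb_mat ::
    "nat \<Rightarrow> nat \<Rightarrow> (rat \<Rightarrow> 'b::comm_ring_1) \<Rightarrow> nat \<Rightarrow> (nat \<Rightarrow> rat mat) \<Rightarrow> (nat \<Rightarrow> 'b) \<Rightarrow> 'b mat" where
  "comb_mat m n emb k A x = mat m n (\<lambda>rc. \<Sum>i<k. emb (A i $$ rc) * x i)"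

definition rat_lin_indep :: "nat \<Rightarrow> (nat \<Rightarrow> 'k::field_char_0) \<Rightarrow> bool" where
  "rat_lin_indep k l \<longleftrightarrow>
     inj_on l {..<k} \<and> \<not> Modules.module.dependent (\<lambda>q x. of_rat q * x) (l ` {..<k})"

definition structural_rank_conjecture :: "'k::field_char_0 set \<Rightarrow> bool" where
  "structural_rank_conjecture L \<longleftrightarrow>
     (\<forall>m\<ge>1. \<forall>n\<ge>1. \<forall>M \<in> carrier_mat m n. elements_mat M \<subseteq> L \<longrightarrow>
       (\<forall>k A l. (\<forall>i<k. A i \<in> carrier_mat m n) \<longrightarrow> (\<forall>i<k. l i \<in> L) \<longrightarrow> rat_lin_indep k l \<longrightarrow>
          M = comb_mat m n of_rat k A l \<longrightarrow>
          vec_space.rank m M = vec_space.rank m (comb_mat m n ratfun_const k A ratfun_var)))"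

definition matrix_coefficient_conjecture :: "'k::field_char_0 set \<Rightarrow> bool" where
  "matrix_coefficient_conjecture L \<longleftrightarrow>
     (\<forall>n\<ge>1. \<forall>M \<in> carrier_mat n n. elements_mat M \<subseteq> L \<longrightarrow> det M = 0 \<longrightarrow>
       (\<exists>w \<in> carrier_vec n. \<exists>v \<in> carrier_vec n. w \<noteq> 0\<^sub>v n \<and> v \<noteq> 0\<^sub>v n \<and>
          map_vec of_rat w \<bullet> (M *\<^sub>v map_vec of_rat v) = 0))"

end

theory Submission
  imports Defs
begin

text \<open>
  The entries of a matrix span a finite-dimensional rational space with a basis among the entries,
  so \<open>M = \<Sum> A i * l i\<close> with rational \<open>A i\<close>, and by the rank hypothesis every rational
  combination of the \<open>A i\<close> is singular.  Such a family has a common isotropic pair: take a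
  member \<open>A\<close> of maximal rank, \<open>v\<close> in its kernel and \<open>w\<close> in its left kernel.
  If \<open>w \<bullet> (B *\<^sub>v v) \<noteq> 0\<close> for another member \<open>B\<close>, some \<open>A + t B\<close> would have larger rank.
\<close>

section \<open>Kernel vectors of non-square matrices\<close>

lemma wide_mat_kernel:
  fixes A :: "'a::idom mat"
  assumes A: "A \<in> carrier_mat k n" and "k < n"
  obtains v where "v \<in> carrier_vec n" "v \<noteq> 0\<^sub>v n" "A *\<^sub>v v = 0\<^sub>v k"
proof -
  define c where "c i = (if i < k then row A i else 0\<^sub>v n)" for i
  \<comment> \<open>Zero rows pad \<open>A\<close> to a square matrix. Since \<open>k < n\<close>,
    row \<open>k\<close> is one of them, so \<open>A'\<close> is singular, and a kernel vector of
    \<open>A'\<close> is one of \<open>A\<close>.\<close>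
  define A' where "A' = mat\<^sub>r n n (\<lambda>i. if i = k then 0\<^sub>v n else c i)"
  have "c \<in> {0..<n} \<rightarrow> carrier_vec n"
    using A by (auto simp: c_def)
  then have "det A' = 0"
    unfolding A'_def by (rule det_row_0[OF \<open>k < n\<close>])
  moreover have A': "A' \<in> carrier_mat n n"
    by (simp add: A'_def)
  ultimately obtain v where v: "v \<in> carrier_vec n" "v \<noteq> 0\<^sub>v n" "A' *\<^sub>v v = 0\<^sub>v n"
    using det_0_iff_vec_prod_zero by blast
  have "A *\<^sub>v v = 0\<^sub>v k"
  proof
    fix i assume "i < dim_vec (0\<^sub>v k :: 'a vec)"
    then have i: "i < k" "i < n" using \<open>k < n\<close> by auto
    have "row A' i = row A i"
      unfolding A'_def using i A by (subst row_mat_of_row_fun) (auto simp: c_def)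
    moreover have "(A' *\<^sub>v v) $ i = 0" using v(3) i by simp
    ultimately show "(A *\<^sub>v v) $ i = 0\<^sub>v k $ i" using i A A' by simp
  qed (use A in auto)
  with v that show thesis by blast
qed

text \<open>The transpose is a wide matrix. Orthogonality to the image of \<open>A\<close> is the
  form in which a left kernel vector enters the Gram matrices below.\<close>

lemma tall_mat_left_kernel:
  fixes A :: "'a::idom mat"
  assumes A: "A \<in> carrier_mat n k" and "k < n"
  obtains w where "w \<in> carrier_vec n" "w \<noteq> 0\<^sub>v n" "\<And>u. u \<in> carrier_vec k \<Longrightarrow> w \<bullet> (A *\<^sub>v u) = 0"
proof -
  have AT: "transpose_mat A \<in> carrier_mat k n" using A by simp
  obtain w where w: "w \<in> carrier_vec n" "w \<noteq> 0\<^sub>v n" "transpose_mat A *\<^sub>v w = 0\<^sub>v k"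
    using wide_mat_kernel[OF AT \<open>k < n\<close>] by blast
  have "w \<bullet> (A *\<^sub>v u) = 0" if u: "u \<in> carrier_vec k" for u
  proof -
    have "w \<bullet> (A *\<^sub>v u) = (transpose_mat A *\<^sub>v w) \<bullet> u"
      using transpose_vec_mult_scalar[OF A u w(1)] by simp
    then show ?thesis using u w(3) by simp
  qed
  with w that show thesis by blast
qed

section \<open>Determinants of bordered Gram matrices\<close>

lemma det_last_col_zero:
  fixes X :: "'a::idom mat"
  assumes X: "X \<in> carrier_mat (Suc k) (Suc k)" and zero: "\<And>i. i < k \<Longrightarrow> X $$ (i, k) = 0"
  shows "det X = det (mat k k (($$) X)) * X $$ (k, k)"
proof -
  \<comment> \<open>The last column vanishes above the corner, so \<open>X\<close> is block lower
    triangular with a 1 by 1 corner block.\<close>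
  have "X = four_block_mat (mat k k (($$) X)) (0\<^sub>m k 1)
      (mat 1 k (\<lambda>(i, j). X $$ (k, j))) (mat 1 1 (\<lambda>_. X $$ (k, k)))"
    using X zero by (auto intro!: eq_matI simp: less_Suc_eq)
  also have "det \<dots> = det (mat k k (($$) X)) * X $$ (k, k)"
    by (subst det_four_block_mat_upper_right_zero_col[of _ k]) (auto simp: det_single)
  finally show ?thesis .
qed

text \<open>The matrix of the bilinear form of \<open>A\<close> on two families of \<open>k\<close>
  vectors. Over a field, \<open>A\<close> has rank at least \<open>k\<close> exactly if some choice
  of the families makes its determinant nonzero; unit vectors give the minors. This is how rank is
  measured below.\<close>

definition gram_mat :: "'a::comm_ring_1 mat \<Rightarrow> (nat \<Rightarrow> 'a vec) \<Rightarrow> (nat \<Rightarrow> 'a vec) \<Rightarrow> nat \<Rightarrow> 'a mat" where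
  "gram_mat A w v k = mat k k (\<lambda>(i, j). w i \<bullet> (A *\<^sub>v v j))"

text \<open>The Gram matrix is \<open>W * A * V\<close>, with the left vectors as rows of
  \<open>W\<close> and the right vectors as columns of \<open>V\<close>, and determinants are
  multiplicative.\<close>

lemma det_gram_mat_singular:
  fixes A :: "'a::comm_ring_1 mat"
  assumes A: "A \<in> carrier_mat n n" and "det A = 0"
    and w: "\<And>i. i < n \<Longrightarrow> w i \<in> carrier_vec n" and v: "\<And>i. i < n \<Longrightarrow> v i \<in> carrier_vec n"
  shows "det (gram_mat A w v n) = 0"
proof -
  define W V where "W = mat_of_rows n (map w [0..<n])" and "V = mat_of_cols n (map v [0..<n])"
  have W: "W \<in> carrier_mat n n" and V: "V \<in> carrier_mat n n"
    by (auto simp: W_def V_def mat_of_rows_def mat_of_cols_def)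
  have "gram_mat A w v n = W * (A * V)"
  proof
    fix i j assume "i < dim_row (W * (A * V))" "j < dim_col (W * (A * V))"
    then have ij: "i < n" "j < n" using W V by auto
    have "row W i = w i" unfolding W_def using ij w by (subst mat_of_rows_row) auto
    moreover have "col V j = v j" unfolding V_def using ij v by (subst col_mat_of_cols) auto
    ultimately show "gram_mat A w v n $$ (i, j) = (W * (A * V)) $$ (i, j)"
      using ij A W V by (simp add: gram_mat_def mult_mat_vec_def)
  qed (use A W V in \<open>auto simp: gram_mat_def\<close>)
  then show ?thesis
    using A W V \<open>det A = 0\<close> by (simp add: det_mult[of _ n])
qed

lemma scalar_prod_line:
  fixes A B :: "'a::comm_ring_1 mat"
  assumes "A \<in> carrier_mat n n" "B \<in> carrier_mat n n" "x \<in> carrier_vec n" "y \<in> carrier_vec n"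
  shows "x \<bullet> ((A + t \<cdot>\<^sub>m B) *\<^sub>v y) = x \<bullet> (A *\<^sub>v y) + t * (x \<bullet> (B *\<^sub>v y))"
proof -
  have "(t \<cdot>\<^sub>m B) *\<^sub>v y = t \<cdot>\<^sub>v (B *\<^sub>v y)"
    using assms by (intro eq_vecI) auto
  then show ?thesis
    using assms by (simp add: add_mult_distrib_mat_vec[of _ n n] scalar_prod_add_distrib[of _ n])
qed

text \<open>
  Bordering a nonsingular Gram matrix of \<open>A\<close> by vectors from its two kernels,
  the determinant on the line \<open>A + t B\<close> is \<open>t\<close> times a polynomial in \<open>t\<close> whose constant
  coefficient is a nonzero multiple of the matrix coefficient of \<open>B\<close>.
\<close>
lemma matrix_coefficient_zero_on_line:
  fixes A B :: "'a::field_char_0 mat"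
  assumes A: "A \<in> carrier_mat n n" and B: "B \<in> carrier_mat n n"
    and w: "\<And>i. i \<le> k \<Longrightarrow> w i \<in> carrier_vec n" and v: "\<And>i. i \<le> k \<Longrightarrow> v i \<in> carrier_vec n"
    and nonsing: "det (gram_mat A w v k) \<noteq> 0"
    and sing: "\<And>t. det (gram_mat (A + t \<cdot>\<^sub>m B) w v (Suc k)) = 0"
    and left: "\<And>j. j < k \<Longrightarrow> w k \<bullet> (A *\<^sub>v v j) = 0"
    and right: "\<And>i. i < k \<Longrightarrow> w i \<bullet> (A *\<^sub>v v k) = 0"
  shows "w k \<bullet> (B *\<^sub>v v k) = 0"
proof -
  have sub: "mat k k (($$) (gram_mat A w v (Suc k))) = gram_mat A w v k"
    by (auto simp: gram_mat_def)
  \<comment> \<open>At the point \<open>t = 0\<close> of the line, the last column is zero above the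
    corner by \<open>right\<close>. The determinant is then a nonzero factor times the corner, which
    must therefore vanish.\<close>
  have "A + 0 \<cdot>\<^sub>m B = A"
    using A B by (intro eq_matI) auto
  with sing[of 0] have "det (gram_mat A w v (Suc k)) = 0"
    by simp
  moreover have "det (gram_mat A w v (Suc k)) = det (gram_mat A w v k) * (w k \<bullet> (A *\<^sub>v v k))"
    using right by (subst det_last_col_zero[of _ k]) (auto simp: sub, auto simp: gram_mat_def)
  ultimately have corner: "w k \<bullet> (A *\<^sub>v v k) = 0"
    using nonsing by simp
  \<comment> \<open>The bordered Gram matrix of \<open>A + t B\<close> as a matrix of polynomials in
    \<open>t\<close>, with its last row divided by \<open>t\<close>. The division is exact because
    \<open>left\<close> and \<open>corner\<close> remove the constant terms of that row.\<close>
  define N where "N = mat (Suc k) (Suc k) (\<lambda>(i, j). if i = k then [:w k \<bullet> (B *\<^sub>v v j):]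
      else [:w i \<bullet> (A *\<^sub>v v j), w i \<bullet> (B *\<^sub>v v j):])"
  have det_eval: "det (map_mat (\<lambda>f. poly f t) N) = poly (det N) t" for t
  proof -
    interpret ev: comm_ring_hom "\<lambda>f. poly f t"
      by unfold_locales auto
    show ?thesis by simp
  qed
  have "poly (det N) t = 0" if "t \<noteq> 0" for t
  proof -
    have "gram_mat (A + t \<cdot>\<^sub>m B) w v (Suc k) = multrow k t (map_mat (\<lambda>f. poly f t) N)"
      using left corner
      by (intro eq_matI)
        (auto simp: gram_mat_def N_def scalar_prod_line[OF A B w v] less_Suc_eq)
    then have "det (multrow k t (map_mat (\<lambda>f. poly f t) N)) = 0"
      using sing[of t] by simp
    moreover have "det (multrow k t (map_mat (\<lambda>f. poly f t) N)) = t * poly (det N) t"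
      by (subst det_multrow[of _ "Suc k"]) (auto simp: N_def det_eval[unfolded N_def])
    ultimately show ?thesis using that by simp
  qed
  \<comment> \<open>The factor \<open>t\<close> could be cancelled only for nonzero
    \<open>t\<close>. In characteristic 0 these are infinitely many roots, so \<open>det N\<close>
    is the zero polynomial and may be evaluated at 0 as well.\<close>
  then have "- {0} \<subseteq> {t. poly (det N) t = 0}"
    by auto
  moreover have "infinite (- {0::'a})"
    using infinite_UNIV_char_0 by (simp add: Compl_eq_Diff_UNIV)
  ultimately have "det N = 0"
    using poly_roots_finite finite_subset by blast
  then have "det (map_mat (\<lambda>f. poly f 0) N) = 0"
    by (simp add: det_eval)
  \<comment> \<open>At \<open>t = 0\<close> the last row of \<open>N\<close> holds the coefficients
    of \<open>B\<close>, the other rows those of \<open>A\<close>, and the last column again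
    vanishes above the corner.\<close>
  moreover have "det (map_mat (\<lambda>f. poly f 0) N) = det (gram_mat A w v k) * (w k \<bullet> (B *\<^sub>v v k))"
  proof -
    have "mat k k (($$) (map_mat (\<lambda>f. poly f 0) N)) = gram_mat A w v k"
      by (auto simp: gram_mat_def N_def)
    then show ?thesis
      using right by (subst det_last_col_zero[of _ k]) (auto simp: N_def)
  qed
  ultimately show ?thesis using nonsing by simp
qed

section \<open>A common isotropic pair for a family of singular matrices\<close>

lemma singular_family_common_zero:
  fixes S :: "'a::field_char_0 mat set"
  assumes S: "S \<subseteq> carrier_mat n n" and "S \<noteq> {}"
    and line: "\<And>A B t. A \<in> S \<Longrightarrow> B \<in> S \<Longrightarrow> A + t \<cdot>\<^sub>m B \<in> S"
    and sing: "\<And>A. A \<in> S \<Longrightarrow> det A = 0"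
  obtains w v where "w \<in> carrier_vec n" "v \<in> carrier_vec n" "w \<noteq> 0\<^sub>v n" "v \<noteq> 0\<^sub>v n"
    "\<And>B. B \<in> S \<Longrightarrow> w \<bullet> (B *\<^sub>v v) = 0"
proof -
  \<comment> \<open>\<open>P k\<close> says that some member of \<open>S\<close> has rank at least
    \<open>k\<close>, witnessed by a nonsingular Gram matrix. The empty determinant is 1, which
    gives \<open>P 0\<close>.\<close>
  define P where "P k \<longleftrightarrow> (\<exists>A\<in>S. \<exists>w v. (\<forall>i<k. w i \<in> carrier_vec n) \<and>
      (\<forall>i<k. v i \<in> carrier_vec n) \<and> det (gram_mat A w v k) \<noteq> 0)" for k
  have "P 0"
    using \<open>S \<noteq> {}\<close> by (auto simp: P_def gram_mat_def)
  moreover have "\<not> P n"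
    using det_gram_mat_singular S sing unfolding P_def by blast
  ultimately obtain k where k: "k < n" "P k" "\<not> P (Suc k)"
    using ex_least_nat_less[of "\<lambda>k. \<not> P k" n] by auto
  from \<open>P k\<close> obtain A w v where A: "A \<in> S" and w: "\<And>i. i < k \<Longrightarrow> w i \<in> carrier_vec n"
    and v: "\<And>i. i < k \<Longrightarrow> v i \<in> carrier_vec n" and det: "det (gram_mat A w v k) \<noteq> 0"
    unfolding P_def by blast
  have An: "A \<in> carrier_mat n n" using A S by blast
  define W V where "W = mat_of_rows n (map w [0..<k])" and "V = mat_of_cols n (map v [0..<k])"
  have W: "W \<in> carrier_mat k n" and V: "V \<in> carrier_mat n k"
    by (auto simp: W_def V_def mat_of_rows_def mat_of_cols_def)
  \<comment> \<open>Membership in the kernel of \<open>W * A\<close> is exactly the vanishing above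
    the corner after bordering by \<open>q\<close>. As \<open>A\<close> has rank \<open>k\<close>
    and \<open>W * A * V\<close> is nonsingular, this kernel is that of \<open>A\<close> itself. The
    choice of \<open>p\<close> from \<open>A * V\<close> is symmetric.\<close>
  obtain q where q: "q \<in> carrier_vec n" "q \<noteq> 0\<^sub>v n" "(W * A) *\<^sub>v q = 0\<^sub>v k"
    using wide_mat_kernel[of "W * A" k n] W An \<open>k < n\<close> by auto
  obtain p where p: "p \<in> carrier_vec n" "p \<noteq> 0\<^sub>v n"
    "\<And>u. u \<in> carrier_vec k \<Longrightarrow> p \<bullet> ((A * V) *\<^sub>v u) = 0"
    using tall_mat_left_kernel[of "A * V" n k] V An \<open>k < n\<close> by auto
  have right: "w i \<bullet> (A *\<^sub>v q) = 0" if "i < k" for i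
  proof -
    have "row W i = w i" unfolding W_def using that w by (subst mat_of_rows_row) auto
    moreover have "W *\<^sub>v (A *\<^sub>v q) = 0\<^sub>v k"
      using assoc_mult_mat_vec[OF W An q(1)] q(3) by metis
    then have "(W *\<^sub>v (A *\<^sub>v q)) $ i = 0" using that by simp
    ultimately show ?thesis using W that by simp
  qed
  have left: "p \<bullet> (A *\<^sub>v v j) = 0" if "j < k" for j
  proof -
    have "col V j = v j" unfolding V_def using that v by (subst col_mat_of_cols) auto
    moreover have "V *\<^sub>v unit_vec k j = col V j"
      using V that by (intro eq_vecI) auto
    ultimately show ?thesis
      using p(3)[of "unit_vec k j"] An V by (simp add: assoc_mult_mat_vec[of _ n n _ k])
  qed
  have "p \<bullet> (B *\<^sub>v q) = 0" if "B \<in> S" for B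
  proof -
    \<comment> \<open>The new vectors take the free index \<open>k\<close>, so the leading
      \<open>k\<close> by \<open>k\<close> Gram matrix is unchanged.\<close>
    let ?w = "w(k := p)" and ?v = "v(k := q)"
    have "?w k \<bullet> (B *\<^sub>v ?v k) = 0"
    proof (rule matrix_coefficient_zero_on_line[OF An, where k = k and w = ?w and v = ?v])
      have "gram_mat A ?w ?v k = gram_mat A w v k"
        by (auto simp: gram_mat_def)
      with det show "det (gram_mat A ?w ?v k) \<noteq> 0" by simp
      \<comment> \<open>The whole line through \<open>A\<close> in direction \<open>B\<close> stays
        in \<open>S\<close>, so a nonzero determinant would contradict the choice of
        \<open>k\<close>.\<close>
      show "det (gram_mat (A + t \<cdot>\<^sub>m B) ?w ?v (Suc k)) = 0" for t
      proof (rule ccontr)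
        assume "det (gram_mat (A + t \<cdot>\<^sub>m B) ?w ?v (Suc k)) \<noteq> 0"
        moreover have "A + t \<cdot>\<^sub>m B \<in> S" using line A that .
        moreover have "\<forall>i<Suc k. ?w i \<in> carrier_vec n" "\<forall>i<Suc k. ?v i \<in> carrier_vec n"
          using w v p q by (auto simp: less_Suc_eq)
        ultimately have "P (Suc k)" unfolding P_def by blast
        with k show False by simp
      qed
    qed (use that S w v p q left right in auto)
    then show ?thesis by simp
  qed
  with p q that show thesis by blast
qed

section \<open>Evaluation of polynomials in countably many variables\<close>

definition monom_eval :: "(nat \<Rightarrow> 'a::comm_ring_1) \<Rightarrow> (nat \<Rightarrow>\<^sub>0 nat) \<Rightarrow> 'a" where
  "monom_eval c m = (\<Prod>i\<in>Poly_Mapping.keys m. c i ^ Poly_Mapping.lookup m i)"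

text \<open>Variables outside the support have exponent 0 and contribute the factor 1. This allows
  monomials with different supports to be compared over one index set.\<close>

lemma monom_eval_superset:
  "finite I \<Longrightarrow> Poly_Mapping.keys m \<subseteq> I \<Longrightarrow> monom_eval c m = (\<Prod>i\<in>I. c i ^ Poly_Mapping.lookup m i)"
  unfolding monom_eval_def
  by (rule prod.mono_neutral_left) (auto simp: in_keys_iff)

lemma monom_eval_0 [simp]: "monom_eval c 0 = 1"
  by (simp add: monom_eval_def)

lemma monom_eval_var [simp]: "monom_eval c (Poly_Mapping.single i 1) = c i"
  by (simp add: monom_eval_def)

lemma monom_eval_add: "monom_eval c (a + b) = monom_eval c a * monom_eval c b"
proof -
  let ?I = "Poly_Mapping.keys a \<union> Poly_Mapping.keys b"
  have "monom_eval c (a + b) = (\<Prod>i\<in>?I. c i ^ Poly_Mapping.lookup (a + b) i)"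
    using Poly_Mapping.keys_add[of a b] by (intro monom_eval_superset) auto
  also have "\<dots> = (\<Prod>i\<in>?I. c i ^ Poly_Mapping.lookup a i) * (\<Prod>i\<in>?I. c i ^ Poly_Mapping.lookup b i)"
    by (simp add: lookup_add power_add prod.distrib)
  finally show ?thesis
    by (simp add: monom_eval_superset[of ?I])
qed

definition mpoly_eval :: "(nat \<Rightarrow> 'a::comm_ring_1) \<Rightarrow> ((nat \<Rightarrow>\<^sub>0 nat) \<Rightarrow>\<^sub>0 'a) \<Rightarrow> 'a" where
  "mpoly_eval c f = (\<Sum>m\<in>Poly_Mapping.keys f. Poly_Mapping.lookup f m * monom_eval c m)"

lemma mpoly_eval_superset:
  "finite I \<Longrightarrow> Poly_Mapping.keys f \<subseteq> I \<Longrightarrow> mpoly_eval c f = (\<Sum>m\<in>I. Poly_Mapping.lookup f m * monom_eval c m)"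
  unfolding mpoly_eval_def
  by (rule sum.mono_neutral_left) (auto simp: in_keys_iff)

lemma mpoly_eval_0 [simp]: "mpoly_eval c 0 = 0"
  by (simp add: mpoly_eval_def)

lemma mpoly_eval_single [simp]: "mpoly_eval c (Poly_Mapping.single m a) = a * monom_eval c m"
  by (subst mpoly_eval_superset[of "{m}"]) auto

lemma mpoly_eval_add: "mpoly_eval c (f + g) = mpoly_eval c f + mpoly_eval c g"
proof -
  let ?I = "Poly_Mapping.keys f \<union> Poly_Mapping.keys g"
  have "mpoly_eval c (f + g) = (\<Sum>m\<in>?I. Poly_Mapping.lookup (f + g) m * monom_eval c m)"
    using Poly_Mapping.keys_add[of f g] by (intro mpoly_eval_superset) auto
  also have "\<dots> = (\<Sum>m\<in>?I. Poly_Mapping.lookup f m * monom_eval c m) + (\<Sum>m\<in>?I. Poly_Mapping.lookup g m * monom_eval c m)"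
    by (simp add: lookup_add distrib_right sum.distrib)
  finally show ?thesis
    by (simp add: mpoly_eval_superset[of ?I])
qed

lemma mpoly_eval_sum: "mpoly_eval c (\<Sum>i\<in>I. f i) = (\<Sum>i\<in>I. mpoly_eval c (f i))"
  by (induction I rule: infinite_finite_induct) (auto simp: mpoly_eval_add)

lemma mpoly_eval_mult: "mpoly_eval c (f * g) = mpoly_eval c f * mpoly_eval c g"
proof -
  \<comment> \<open>Splitting both factors into monomials reduces multiplicativity to products of
    two monomials.\<close>
  have sum_singles: "h = (\<Sum>m\<in>Poly_Mapping.keys h. Poly_Mapping.single m (Poly_Mapping.lookup h m))"
    for h :: "(nat \<Rightarrow>\<^sub>0 nat) \<Rightarrow>\<^sub>0 'a"
    by (rule poly_mapping_eqI) (auto simp: lookup_sum lookup_single when_def in_keys_iff)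
  have "mpoly_eval c (f * g) = mpoly_eval c
      ((\<Sum>m\<in>Poly_Mapping.keys f. Poly_Mapping.single m (Poly_Mapping.lookup f m)) *
       (\<Sum>m\<in>Poly_Mapping.keys g. Poly_Mapping.single m (Poly_Mapping.lookup g m)))"
    using sum_singles[of f] sum_singles[of g] by metis
  also have "\<dots> = mpoly_eval c f * mpoly_eval c g"
    by (simp add: sum_product mult_single mpoly_eval_sum monom_eval_add mpoly_eval_def[of c f]
        mpoly_eval_def[of c g] algebra_simps)
  finally show ?thesis .
qed

lemma comm_ring_hom_mpoly_eval: "comm_ring_hom (mpoly_eval c)"
  by unfold_locales
    (simp_all add: mpoly_eval_add mpoly_eval_mult flip: single_one)

text \<open>Rational functions cannot be evaluated at every point because of denominators. The
  generic matrix, however, has polynomial entries: its determinant already vanishes in the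
  polynomial ring, which embeds in its fraction field, and there substituting \<open>c\<close> is a
  ring homomorphism.\<close>

lemma det_comb_mat_specialize:
  assumes "det (comb_mat n n ratfun_const k A ratfun_var) = 0"
  shows "det (comb_mat n n id k A c) = 0"
proof -
  define X :: "((nat \<Rightarrow>\<^sub>0 nat) \<Rightarrow>\<^sub>0 rat) mat"
    where "X = comb_mat n n (Poly_Mapping.single 0) k A
      (\<lambda>i. Poly_Mapping.single (Poly_Mapping.single i 1) 1)"
  interpret frac: inj_comm_ring_hom "to_fract :: ((nat \<Rightarrow>\<^sub>0 nat) \<Rightarrow>\<^sub>0 rat) \<Rightarrow> _"
    by unfold_locales auto
  interpret ev: comm_ring_hom "mpoly_eval c"
    by (rule comm_ring_hom_mpoly_eval)
  have "comb_mat n n ratfun_const k A ratfun_var = map_mat to_fract X"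
    by (auto simp: comb_mat_def X_def ratfun_const_def ratfun_var_def)
  then have "det X = 0"
    using assms by simp
  moreover have "comb_mat n n id k A c = map_mat (mpoly_eval c) X"
    by (auto simp: comb_mat_def X_def mpoly_eval_sum mult_single simp del: One_nat_def)
  ultimately show ?thesis by simp
qed

section \<open>Rational combinations of coefficient matrices\<close>

lemma comb_mat_common_zero:
  assumes "\<And>c. det (comb_mat n n id k A c) = (0::rat)" and A: "\<And>i. i < k \<Longrightarrow> A i \<in> carrier_mat n n"
  obtains w v where "w \<in> carrier_vec n" "v \<in> carrier_vec n" "w \<noteq> 0\<^sub>v n" "v \<noteq> 0\<^sub>v n"
    "\<And>i. i < k \<Longrightarrow> w \<bullet> (A i *\<^sub>v v) = 0"
proof -
  let ?S = "range (comb_mat n n id k A)"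
  have line: "X + t \<cdot>\<^sub>m Y \<in> ?S" if "X \<in> ?S" "Y \<in> ?S" for X Y t
  proof -
    from that obtain c d where "X = comb_mat n n id k A c" "Y = comb_mat n n id k A d"
      by blast
    then have "X + t \<cdot>\<^sub>m Y = comb_mat n n id k A (\<lambda>i. c i + t * d i)"
      by (auto simp: comb_mat_def algebra_simps sum.distrib sum_distrib_left)
    then show ?thesis by blast
  qed
  obtain w v where wv: "w \<in> carrier_vec n" "v \<in> carrier_vec n" "w \<noteq> 0\<^sub>v n" "v \<noteq> 0\<^sub>v n"
    and zero: "\<And>B. B \<in> ?S \<Longrightarrow> w \<bullet> (B *\<^sub>v v) = 0"
    by (rule singular_family_common_zero[of ?S n]) (use assms(1) line in \<open>auto simp: comb_mat_def\<close>)
  have "w \<bullet> (A i *\<^sub>v v) = 0" if "i < k" for i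
  proof -
    \<comment> \<open>Indicator coefficients recover each \<open>A i\<close> as a member of the
      family.\<close>
    have "A i = comb_mat n n id k A (\<lambda>j. if j = i then 1 else 0)"
      using A[OF that] that
      by (intro eq_matI) (auto simp: comb_mat_def if_distrib[of "(*) _"] cong: if_cong)
    with zero show ?thesis by (metis rangeI)
  qed
  with wv that show thesis by blast
qed

text \<open>By bilinearity the scalars \<open>l i\<close> come out of the matrix coefficient, so
  rational vectors that annihilate every \<open>A i\<close> annihilate the combination.\<close>

lemma comb_mat_coefficient:
  fixes l :: "nat \<Rightarrow> 'k::field_char_0"
  assumes A: "\<And>i. i < k \<Longrightarrow> A i \<in> carrier_mat n n"
    and w: "w \<in> carrier_vec n" and v: "v \<in> carrier_vec n"
  shows "map_vec of_rat w \<bullet> (comb_mat n n of_rat k A l *\<^sub>v map_vec of_rat v) =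
    (\<Sum>i<k. of_rat (w \<bullet> (A i *\<^sub>v v)) * l i)"
proof -
  have "map_vec of_rat w \<bullet> (comb_mat n n of_rat k A l *\<^sub>v map_vec of_rat v) =
    (\<Sum>r<n. \<Sum>s<n. \<Sum>i<k. of_rat (w $ r * (A i $$ (r, s) * v $ s)) * l i)"
    using w v
    by (auto simp: scalar_prod_def comb_mat_def atLeast0LessThan of_rat_mult sum_distrib_left
        sum_distrib_right mult_ac intro!: sum.cong)
  also have "\<dots> = (\<Sum>r<n. \<Sum>i<k. \<Sum>s<n. of_rat (w $ r * (A i $$ (r, s) * v $ s)) * l i)"
    by (intro sum.cong refl sum.swap)
  also have "\<dots> = (\<Sum>i<k. \<Sum>r<n. \<Sum>s<n. of_rat (w $ r * (A i $$ (r, s) * v $ s)) * l i)"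
    by (rule sum.swap)
  also have "\<dots> = (\<Sum>i<k. of_rat (w \<bullet> (A i *\<^sub>v v)) * l i)"
  proof (intro sum.cong refl)
    fix i assume "i \<in> {..<k}"
    then show "(\<Sum>r<n. \<Sum>s<n. of_rat (w $ r * (A i $$ (r, s) * v $ s)) * l i) =
        of_rat (w \<bullet> (A i *\<^sub>v v)) * l i"
      using A[of i] w v
      by (simp add: scalar_prod_def atLeast0LessThan of_rat_sum sum_distrib_left sum_distrib_right)
  qed
  finally show ?thesis .
qed

lemma vector_space_of_rat: "vector_space (\<lambda>q x :: 'k::field_char_0. of_rat q * x)"
  by unfold_locales (auto simp: algebra_simps of_rat_add of_rat_mult)

text \<open>A maximal rationally independent set of entries serves as the basis. Taking it among the
  entries keeps every \<open>l i\<close> in any set that contains all entries of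
  \<open>M\<close>.\<close>

lemma rational_decomposition:
  fixes M :: "'k::field_char_0 mat"
  assumes M: "M \<in> carrier_mat m n"
  obtains k A l where "\<And>i. i < k \<Longrightarrow> A i \<in> carrier_mat m n" "\<And>i. i < k \<Longrightarrow> l i \<in> elements_mat M"
    "rat_lin_indep k l" "M = comb_mat m n of_rat k A l"
proof -
  interpret Q: vector_space "\<lambda>q x :: 'k. of_rat q * x"
    by (rule vector_space_of_rat)
  obtain B where B: "B \<subseteq> elements_mat M" "Q.independent B" "elements_mat M \<subseteq> Q.span B"
    by (rule Q.maximal_independent_subset)
  have fin: "finite B"
    using B(1) by (rule finite_subset) (simp add: elements_mat_def)
  obtain l where l: "bij_betw l {..<card B} B"
    using ex_bij_betw_nat_finite[OF fin] by (auto simp: atLeast0LessThan)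
  have "\<exists>c. x = (\<Sum>i<card B. of_rat (c i) * l i)" if "x \<in> elements_mat M" for x
  proof -
    have "x \<in> range (\<lambda>u. \<Sum>b\<in>B. of_rat (u b) * b)"
      using that B(3) Q.span_finite[OF fin] by (metis subsetD)
    then obtain u where "x = (\<Sum>b\<in>B. of_rat (u b) * b)"
      by (rule rangeE)
    also have "\<dots> = (\<Sum>i<card B. of_rat (u (l i)) * l i)"
      using sum.reindex_bij_betw[OF l, of "\<lambda>b. of_rat (u b) * b"] by simp
    finally show ?thesis by (rule exI[of _ "\<lambda>i. u (l i)"])
  qed
  then obtain c where c: "\<And>x. x \<in> elements_mat M \<Longrightarrow> x = (\<Sum>i<card B. of_rat (c x i) * l i)"
    by metis
  show thesis
  proof (rule that[of "card B" "\<lambda>i. mat m n (\<lambda>rc. c (M $$ rc) i)" l])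
    show "M = comb_mat m n of_rat (card B) (\<lambda>i. mat m n (\<lambda>rc. c (M $$ rc) i)) l"
    proof
      fix r s assume "r < dim_row (comb_mat m n of_rat (card B) (\<lambda>i. mat m n (\<lambda>rc. c (M $$ rc) i)) l)"
        "s < dim_col (comb_mat m n of_rat (card B) (\<lambda>i. mat m n (\<lambda>rc. c (M $$ rc) i)) l)"
      then have rs: "r < m" "s < n" by (auto simp: comb_mat_def)
      then have "M $$ (r, s) \<in> elements_mat M" using M by auto
      from c[OF this] show "M $$ (r, s) =
          comb_mat m n of_rat (card B) (\<lambda>i. mat m n (\<lambda>rc. c (M $$ rc) i)) l $$ (r, s)"
        using rs by (simp add: comb_mat_def)
    qed (use M in \<open>auto simp: comb_mat_def\<close>)
    show "rat_lin_indep (card B) l"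
      using l B(2) by (simp add: rat_lin_indep_def bij_betw_def)
  qed (use l B(1) in \<open>auto simp: bij_betw_def\<close>)
qed

text \<open>For a square matrix, rank below \<open>n\<close> means determinant 0, so the rank
  equality carries singularity from \<open>M\<close> to the generic matrix and thence to all
  rational specializations. Their common isotropic pair serves for \<open>M\<close>.\<close>

lemma structural_rank_imp_matrix_coefficient:
  assumes src: "structural_rank_conjecture L"
  shows "matrix_coefficient_conjecture L"
  unfolding matrix_coefficient_conjecture_def
proof (intro allI impI ballI)
  fix n :: nat and M :: "'a mat"
  assume "n \<ge> 1" and M: "M \<in> carrier_mat n n" and sub: "elements_mat M \<subseteq> L" and "det M = 0"
  obtain k A l where A: "\<And>i. i < k \<Longrightarrow> A i \<in> carrier_mat n n"
    and l: "\<And>i. i < k \<Longrightarrow> l i \<in> elements_mat M" "rat_lin_indep k l"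
    and eq: "M = comb_mat n n of_rat k A l"
    using rational_decomposition[OF M] by blast
  have "vec_space.rank n M = vec_space.rank n (comb_mat n n ratfun_const k A ratfun_var)"
    using src[unfolded structural_rank_conjecture_def, rule_format, OF \<open>n \<ge> 1\<close> \<open>n \<ge> 1\<close> M sub]
      A l sub eq by blast
  moreover have "vec_space.rank n M \<noteq> n"
    using vec_space.det_rank_iff[OF M] \<open>det M = 0\<close> by simp
  ultimately have "det (comb_mat n n ratfun_const k A ratfun_var) = 0"
    using vec_space.det_rank_iff[of "comb_mat n n ratfun_const k A ratfun_var" n]
    by (auto simp: comb_mat_def)
  then obtain w v where "w \<in> carrier_vec n" "v \<in> carrier_vec n" "w \<noteq> 0\<^sub>v n" "v \<noteq> 0\<^sub>v n"
    "\<And>i. i < k \<Longrightarrow> w \<bullet> (A i *\<^sub>v v) = 0"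
    using comb_mat_common_zero[of n k A] det_comb_mat_specialize A by blast
  then show "\<exists>w\<in>carrier_vec n. \<exists>v\<in>carrier_vec n. w \<noteq> 0\<^sub>v n \<and> v \<noteq> 0\<^sub>v n \<and>
      map_vec of_rat w \<bullet> (M *\<^sub>v map_vec of_rat v) = 0"
    by (intro bexI[of _ w] bexI[of _ v]) (auto simp: eq comb_mat_coefficient A)
qed

theorem theorem2p1:
  fixes p :: nat
  shows "(structural_rank_conjecture complex_logs \<longrightarrow>
            matrix_coefficient_conjecture complex_logs) \<and>
         (padic_complex_field TYPE('k::{field_char_0, complete_space}) p \<longrightarrow>
            structural_rank_conjecture (padic_logs p :: 'k set) \<longrightarrow>
            matrix_coefficient_conjecture (padic_logs p :: 'k set))"
  by (intro conjI impI structural_rank_imp_matrix_coefficient)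

end
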